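(* Let $(Q,\cdot)$ be a loop with a self-map $\sigma:Q\to Q$, let $A(Q)$ be a group of automorphisms of $(Q,\cdot)$, and let $(H,\circ)$ be the $A$-holomorph of $(Q,\cdot)$, equipped with the self-map $\sigma'(\alpha,x)=(\alpha,\sigma(x))$ for all $(\alpha,x)\in H$. Then $(Q,\cdot)$ is a $\sigma\alpha\gamma^{-1}$-generalised flexible-Bol loop for all $\alpha,\gamma\in A(Q)$ if and only if $(H,\circ)$ is a $\sigma'$-generalised flexible-Bol loop.
   Context: Juxtaposition binds more tightly than $\cdot$, so $xy\cdot z=(x\cdot y)\cdot z$. A loop is a quasigroup with two-sided identity. A loop $(L,\cdot)$ with self-map $\sigma$ (an arbitrary function) is a $\sigma$-generalised (right) Bol loop if $(xy\cdot z)\sigma(y)=x(yz\cdot\sigma(y))$ for all $x,y,z\in L$. $A$-holomorph: for a subgroup $A(Q)$ of the automorphism group of $(Q,\cdot)$, put $H=A(Q)\times Q$ with $(\alpha,x)\circ(\beta,y)=(\alpha\beta,\,x\beta\cdot y)$, where automorphisms act on the right and $x(\alpha\beta)=(x\alpha)\beta$. Then $(H,\circ)$ is a loop, called the $A$-holomorph of $(Q,\cdot)$. Flexibility: the loop $(Q,\cdot)$ with self-map $\sigma$ is $\sigma$-flexible if, for some $\delta\in A(Q)$, $xy\cdot\sigma(x\delta)=x\cdot y\sigma(x\delta)$ for all $x,y\in Q$. The holomorph $(H,\circ)$ with self-map $\sigma'$ is $\sigma'$-flexible if $(h\circ k)\circ\sigma'(h)=h\circ(k\circ\sigma'(h))$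 for all $h,k\in H$. A loop ($Q$ or $H$) that is both $\sigma$-generalised Bol and $\sigma$-flexible (respectively with $\sigma'$) is called a $\sigma$-generalised flexible-Bol loop. When automorphisms are composed with the self-map $\sigma$, function notation on the left is used, with $\alpha(x)=x\alpha$: $\sigma\alpha\gamma^{-1}$ is the self-map $x\mapsto\sigma(\alpha(\gamma^{-1}(x)))=\sigma((x\gamma^{-1})\alpha)$. *)

theory Defs
  imports "HOL-Algebra.Bij"
begin

locale quasigroup =
  fixes Q :: "('a, 'm) monoid_scheme" (structure)
  assumes mult_closed: "\<lbrakk>x \<in> carrier Q; y \<in> carrier Q\<rbrakk> \<Longrightarrow> x \<otimes> y \<in> carrier Q"
    and left_division: "\<lbrakk>a \<in> carrier Q; b \<in> carrier Q\<rbrakk> \<Longrightarrow> \<exists>!x. x \<in> carrier Q \<and> a \<otimes> x = b"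
    and right_division: "\<lbrakk>a \<in> carrier Q; b \<in> carrier Q\<rbrakk> \<Longrightarrow> \<exists>!y. y \<in> carrier Q \<and> y \<otimes> a = b"

locale loop = quasigroup +
  assumes one_in_carrier: "\<one> \<in> carrier Q"
    and left_one: "x \<in> carrier Q \<Longrightarrow> \<one> \<otimes> x = x"
    and right_one: "x \<in> carrier Q \<Longrightarrow> x \<otimes> \<one> = x"

locale generalised_Bol_loop = loop +
  fixes \<sigma> :: "'a \<Rightarrow> 'a"
  assumes self_map: "\<sigma> \<in> carrier Q \<rightarrow> carrier Q"
    and Bol: "\<lbrakk>x \<in> carrier Q; y \<in> carrier Q; z \<in> carrier Q\<rbrakk>
      \<Longrightarrow> ((x \<otimes> y) \<otimes> z) \<otimes> \<sigma> y = x \<otimes> ((y \<otimes> z) \<otimes> \<sigma> y)"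

definition flexible :: "('a, 'm) monoid_scheme \<Rightarrow> ('a \<Rightarrow> 'a) \<Rightarrow> bool" where
  "flexible L \<sigma> \<longleftrightarrow> (\<forall>x \<in> carrier L. \<forall>y \<in> carrier L.
     (x \<otimes>\<^bsub>L\<^esub> y) \<otimes>\<^bsub>L\<^esub> \<sigma> x = x \<otimes>\<^bsub>L\<^esub> (y \<otimes>\<^bsub>L\<^esub> \<sigma> x))"

(* Flexibility of a loop relative to a group A of its automorphisms:
   a single automorphism twisting the argument of the self-map suffices. *)
definition A_flexible ::
  "('a \<Rightarrow> 'a) set \<Rightarrow> ('a, 'm) monoid_scheme \<Rightarrow> ('a \<Rightarrow> 'a) \<Rightarrow> bool" where
  "A_flexible A Q \<sigma> \<longleftrightarrow> (\<exists>\<delta> \<in> A. \<forall>x \<in> carrier Q. \<forall>y \<in> carrier Q.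
     (x \<otimes>\<^bsub>Q\<^esub> y) \<otimes>\<^bsub>Q\<^esub> \<sigma> (\<delta> x) = x \<otimes>\<^bsub>Q\<^esub> (y \<otimes>\<^bsub>Q\<^esub> \<sigma> (\<delta> x)))"

definition generalised_flexible_Bol_loop ::
  "('a, 'm) monoid_scheme \<Rightarrow> ('a \<Rightarrow> 'a) \<Rightarrow> bool" where
  "generalised_flexible_Bol_loop L \<sigma> \<longleftrightarrow> generalised_Bol_loop L \<sigma> \<and> flexible L \<sigma>"

definition A_generalised_flexible_Bol_loop ::
  "('a \<Rightarrow> 'a) set \<Rightarrow> ('a, 'm) monoid_scheme \<Rightarrow> ('a \<Rightarrow> 'a) \<Rightarrow> bool" where
  "A_generalised_flexible_Bol_loop A Q \<sigma> \<longleftrightarrow> generalised_Bol_loop Q \<sigma> \<and> A_flexible A Q \<sigma>"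

(* (\<alpha>, x) (\<beta>, y) = (\<alpha>\<beta>, x\<beta> y) with automorphisms acting on the right. The product of
   AutoGroup composes functions acting on the left, so the right-action product
   \<alpha>\<beta> (first \<alpha>, then \<beta>) is \<beta> \<otimes> \<alpha> there. *)
definition holomorph ::
  "('a \<Rightarrow> 'a) set \<Rightarrow> ('a, 'm) monoid_scheme \<Rightarrow> (('a \<Rightarrow> 'a) \<times> 'a) monoid" where
  "holomorph A Q =
    \<lparr>carrier = A \<times> carrier Q,
     mult = (\<lambda>(\<alpha>, x) (\<beta>, y). (\<beta> \<otimes>\<^bsub>AutoGroup Q\<^esub> \<alpha>, \<beta> x \<otimes>\<^bsub>Q\<^esub> y)),
     one = (\<one>\<^bsub>AutoGroup Q\<^esub>, \<one>\<^bsub>Q\<^esub>)\<rparr>"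

definition holomorph_map :: "('a \<Rightarrow> 'a) \<Rightarrow> ('a \<Rightarrow> 'a) \<times> 'a \<Rightarrow> ('a \<Rightarrow> 'a) \<times> 'a" where
  "holomorph_map \<sigma> = (\<lambda>(\<alpha>, x). (\<alpha>, \<sigma> x))"

end

theory Submission
  imports Defs
begin

text \<open>
  Expanding the products in the holomorph, the Bol identity for \<open>\<sigma>'\<close> at
  \<open>(\<alpha>, x)\<close>, \<open>(\<beta>, y)\<close>, \<open>(\<gamma>, z)\<close> becomes an identity in \<open>Q\<close> in which \<open>x\<close>, \<open>y\<close> and \<open>z\<close>
  occur under automorphisms, except for one untwisted \<open>y\<close> under \<open>\<sigma>\<close>. Automorphisms permute
  \<open>Q\<close>, so the twisted arguments can be taken as new variables; the remaining \<open>y\<close> is then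
  \<open>\<theta> y'\<close> for an automorphism \<open>\<theta>\<close> which runs through all of \<open>A(Q)\<close>. Thus \<open>H\<close> satisfies the
  Bol identity for \<open>\<sigma>'\<close> if and only if \<open>Q\<close> satisfies it for every \<open>\<sigma>\<theta>\<close>, and in the same way
  \<open>H\<close> is flexible for \<open>\<sigma>'\<close> if and only if \<open>Q\<close> is flexible for every \<open>\<sigma>\<theta>\<close>
  (lemmas \<open>right_Bol_identity_holomorph\<close> and \<open>flexible_holomorph\<close>).
  On the other side of the equivalence, the maps \<open>\<sigma>\<alpha>\<gamma>\<inverse>\<close> are also just the maps \<open>\<sigma>\<theta>\<close>.

  What is left is a difference of quantifiers: the flexibility assumed of \<open>Q\<close> provides only
  \<^emph>\<open>some\<close> automorphism \<open>\<tau>\<close> such that \<open>Q\<close> is flexible for \<open>\<sigma>\<tau>\<close>, whereas the holomorph needs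
  flexibility for \<^emph>\<open>every\<close> \<open>\<sigma>\<theta>\<close>. The gap is closed by the observation that, for a generalised
  Bol loop, flexibility is equivalent to the left inverse property (lemma
  \<open>flexible_iff_left_inverse_property\<close>), and the latter does not mention the self-map.
  Since \<open>Q\<close> is a generalised Bol loop for all the maps \<open>\<sigma>\<theta>\<close>, flexibility for one of them
  gives flexibility for all.
\<close>

section \<open>Flexibility and the left inverse property\<close>

definition right_Bol_identity :: "('a, 'm) monoid_scheme \<Rightarrow> ('a \<Rightarrow> 'a) \<Rightarrow> bool" where
  "right_Bol_identity L \<sigma> \<longleftrightarrow>
     (\<forall>x \<in> carrier L. \<forall>y \<in> carrier L. \<forall>z \<in> carrier L.
        ((x \<otimes>\<^bsub>L\<^esub> y) \<otimes>\<^bsub>L\<^esub> z) \<otimes>\<^bsub>L\<^esub> \<sigma> y = x \<otimes>\<^bsub>L\<^esub> ((y \<otimes>\<^bsub>L\<^esub> z) \<otimes>\<^bsub>L\<^esub> \<sigma> y))"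

definition left_inverse_property :: "('a, 'm) monoid_scheme \<Rightarrow> bool" where
  "left_inverse_property L \<longleftrightarrow>
     (\<forall>x \<in> carrier L. \<forall>y \<in> carrier L. \<forall>u \<in> carrier L.
        x \<otimes>\<^bsub>L\<^esub> y = \<one>\<^bsub>L\<^esub> \<longrightarrow> x \<otimes>\<^bsub>L\<^esub> (y \<otimes>\<^bsub>L\<^esub> u) = u)"

lemma generalised_Bol_loop_iff:
  "generalised_Bol_loop L \<sigma> \<longleftrightarrow>
     loop L \<and> \<sigma> \<in> carrier L \<rightarrow> carrier L \<and> right_Bol_identity L \<sigma>"
  unfolding generalised_Bol_loop_def generalised_Bol_loop_axioms_def right_Bol_identity_def
  by blast

lemma right_Bol_identity_cong:
  assumes "\<And>x. x \<in> carrier L \<Longrightarrow> \<sigma> x = \<rho> x"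
  shows "right_Bol_identity L \<sigma> \<longleftrightarrow> right_Bol_identity L \<rho>"
  using assms unfolding right_Bol_identity_def by simp

lemma flexible_cong:
  assumes "\<And>x. x \<in> carrier L \<Longrightarrow> \<sigma> x = \<rho> x"
  shows "flexible L \<sigma> \<longleftrightarrow> flexible L \<rho>"
  using assms unfolding flexible_def by simp

lemma (in quasigroup) left_cancel:
  assumes "a \<in> carrier Q" "x \<in> carrier Q" "y \<in> carrier Q" "a \<otimes> x = a \<otimes> y"
  shows "x = y"
  using left_division[of a "a \<otimes> y"] mult_closed assms by metis

text \<open>
  For \<open>x y = 1\<close> the Bol identity reads \<open>z \<sigma>(y) = x (y z \<cdot> \<sigma>(y))\<close>. Flexibility allows the
  bracket to be moved, giving \<open>w = x (y w)\<close> with \<open>w = z \<sigma>(y)\<close>, and every element has this form.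
  Conversely, the left inverse property gives \<open>z \<sigma>(y) = x (y \<cdot> z \<sigma>(y))\<close>, and cancelling \<open>x\<close>
  leaves the flexible law.
\<close>

lemma (in generalised_Bol_loop) flexible_iff_left_inverse_property:
  "flexible Q \<sigma> \<longleftrightarrow> left_inverse_property Q"
proof
  have Bol_inverse: "z \<otimes> \<sigma> y = x \<otimes> ((y \<otimes> z) \<otimes> \<sigma> y)"
    if "x \<in> carrier Q" "y \<in> carrier Q" "z \<in> carrier Q" "x \<otimes> y = \<one>" for x y z
    using Bol[of x y z] that left_one by simp
  have \<sigma>_closed: "\<sigma> y \<in> carrier Q" if "y \<in> carrier Q" for y
    using self_map that by blast
  show "left_inverse_property Q" if flex: "flexible Q \<sigma>"
    unfolding left_inverse_property_def
  proof (intro ballI impI)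
    fix x y u
    assume xyu: "x \<in> carrier Q" "y \<in> carrier Q" "u \<in> carrier Q" and "x \<otimes> y = \<one>"
    obtain z where z: "z \<in> carrier Q" "z \<otimes> \<sigma> y = u"
      using right_division[of "\<sigma> y" u] \<sigma>_closed xyu by blast
    have "u = x \<otimes> ((y \<otimes> z) \<otimes> \<sigma> y)"
      using Bol_inverse xyu z \<open>x \<otimes> y = \<one>\<close> by metis
    also have "\<dots> = x \<otimes> (y \<otimes> u)"
      using flex xyu z unfolding flexible_def by metis
    finally show "x \<otimes> (y \<otimes> u) = u" by simp
  qed
  show "flexible Q \<sigma>" if lip: "left_inverse_property Q"
    unfolding flexible_def
  proof (intro ballI)
    fix y z
    assume yz: "y \<in> carrier Q" "z \<in> carrier Q"
    obtain x where x: "x \<in> carrier Q" "x \<otimes> y = \<one>"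
      using right_division[of y \<one>] one_in_carrier yz by blast
    have "x \<otimes> ((y \<otimes> z) \<otimes> \<sigma> y) = z \<otimes> \<sigma> y"
      using Bol_inverse x yz by metis
    also have "\<dots> = x \<otimes> (y \<otimes> (z \<otimes> \<sigma> y))"
      using lip x yz \<sigma>_closed mult_closed unfolding left_inverse_property_def by metis
    finally show "(y \<otimes> z) \<otimes> \<sigma> y = y \<otimes> (z \<otimes> \<sigma> y)"
      using left_cancel x yz \<sigma>_closed mult_closed by metis
  qed
qed

section \<open>Groups of automorphisms of a loop\<close>

lemma (in quasigroup) group_AutoGroup: "group (AutoGroup Q)"
proof -
  have "subgroup (auto Q) (BijGroup (carrier Q))"
  proof (rule subgroup.intro)
    show "auto Q \<subseteq> carrier (BijGroup (carrier Q))"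
      by (force simp: auto_def BijGroup_def)
    show "f \<otimes>\<^bsub>BijGroup (carrier Q)\<^esub> g \<in> auto Q" if "f \<in> auto Q" "g \<in> auto Q" for f g
    proof -
      have "compose (carrier Q) f g \<in> hom Q Q"
        using that by (auto simp: auto_def hom_def compose_def Pi_iff mult_closed)
      then show ?thesis
        using that by (simp add: BijGroup_def auto_def compose_Bij)
    qed
    show "\<one>\<^bsub>BijGroup (carrier Q)\<^esub> \<in> auto Q"
      by (auto simp: BijGroup_def auto_def hom_def id_Bij mult_closed)
    show "inv\<^bsub>BijGroup (carrier Q)\<^esub> f \<in> auto Q" if "f \<in> auto Q" for f
    proof -
      have f: "f \<in> hom Q Q" "f \<in> Bij (carrier Q)"
        using that by (auto simp: auto_def)
      have "mult Q \<in> carrier Q \<rightarrow> carrier Q \<rightarrow> carrier Q"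
        by (simp add: mult_closed)
      then have "restrict (inv_into (carrier Q) f) (carrier Q) \<in> hom Q Q"
        using f Bij_inv_into_lemma[of "carrier Q" f "mult Q"]
        by (auto simp: hom_def Bij_inv_into_mem mult_closed)
      then show ?thesis
        using f by (simp del: restrict_apply add: inv_BijGroup auto_def restrict_inv_into_Bij)
    qed
  qed
  then show ?thesis
    by (simp add: AutoGroup_def subgroup.subgroup_is_group group_BijGroup)
qed

locale loop_automorphisms = loop Q + Aut: subgroup A "AutoGroup Q"
  for Q :: "('a, 'm) monoid_scheme" (structure) and A :: "('a \<Rightarrow> 'a) set"
begin

abbreviation (input) aut_mult (infixl "\<star>" 70) where
  "\<alpha> \<star> \<beta> \<equiv> \<alpha> \<otimes>\<^bsub>AutoGroup Q\<^esub> \<beta>"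

abbreviation (input) aut_inv where
  "aut_inv \<alpha> \<equiv> inv\<^bsub>AutoGroup Q\<^esub> \<alpha>"

sublocale AutG: group "AutoGroup Q"
  by (rule group_AutoGroup)

lemma in_Bij: "\<alpha> \<in> A \<Longrightarrow> \<alpha> \<in> Bij (carrier Q)"
  using Aut.subset by (auto simp: AutoGroup_def auto_def)

lemma aut_closed [simp]: "\<lbrakk>\<alpha> \<in> A; x \<in> carrier Q\<rbrakk> \<Longrightarrow> \<alpha> x \<in> carrier Q"
  using in_Bij Bij_imp_funcset by blast

lemma aut_distrib:
  "\<lbrakk>\<alpha> \<in> A; x \<in> carrier Q; y \<in> carrier Q\<rbrakk> \<Longrightarrow> \<alpha> (x \<otimes> y) = \<alpha> x \<otimes> \<alpha> y"
  using Aut.subset by (auto simp: AutoGroup_def auto_def hom_def)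

lemma aut_mult_apply:
  "\<lbrakk>\<alpha> \<in> A; \<beta> \<in> A; x \<in> carrier Q\<rbrakk> \<Longrightarrow> (\<alpha> \<star> \<beta>) x = \<alpha> (\<beta> x)"
  using in_Bij by (simp add: AutoGroup_def BijGroup_def compose_def)

lemma aut_one_apply: "x \<in> carrier Q \<Longrightarrow> \<one>\<^bsub>AutoGroup Q\<^esub> x = x"
  by (simp add: AutoGroup_def BijGroup_def)

lemma aut_inv_apply:
  assumes "\<alpha> \<in> A" "x \<in> carrier Q"
  shows "\<alpha> (aut_inv \<alpha> x) = x" "aut_inv \<alpha> (\<alpha> x) = x"
  using aut_mult_apply[of \<alpha> "aut_inv \<alpha>" x] aut_mult_apply[of "aut_inv \<alpha>" \<alpha> x]
    assms aut_one_apply by simp_all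

lemma aut_fixes_one:
  assumes "\<alpha> \<in> A"
  shows "\<alpha> \<one> = \<one>"
proof (rule left_cancel)
  show "\<alpha> \<one> \<otimes> \<alpha> \<one> = \<alpha> \<one> \<otimes> \<one>"
    using assms aut_distrib[of \<alpha> \<one> \<one>] by (simp add: one_in_carrier right_one)
qed (use assms one_in_carrier in simp_all)

section \<open>The holomorph\<close>

abbreviation H where "H \<equiv> holomorph A Q"

lemma carrier_holomorph: "carrier H = A \<times> carrier Q"
  by (simp add: holomorph_def)

lemma mult_holomorph: "(\<alpha>, x) \<otimes>\<^bsub>H\<^esub> (\<beta>, y) = (\<beta> \<star> \<alpha>, \<beta> x \<otimes> y)"
  by (simp add: holomorph_def)

lemma one_holomorph: "\<one>\<^bsub>H\<^esub> = (\<one>\<^bsub>AutoGroup Q\<^esub>, \<one>)"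
  by (simp add: holomorph_def)

lemma aut_left_solution:
  assumes "\<alpha> \<in> A" "\<beta> \<in> A" "\<xi> \<in> A"
  shows "\<alpha> \<star> \<xi> = \<beta> \<longleftrightarrow> \<xi> = aut_inv \<alpha> \<star> \<beta>"
  using assms by (metis AutG.inv_solve_left Aut.mem_carrier)

lemma aut_right_solution:
  assumes "\<alpha> \<in> A" "\<beta> \<in> A" "\<xi> \<in> A"
  shows "\<xi> \<star> \<alpha> = \<beta> \<longleftrightarrow> \<xi> = \<beta> \<star> aut_inv \<alpha>"
  using assms by (metis AutG.inv_solve_right Aut.mem_carrier)

lemma loop_holomorph: "loop H"
proof
  show "h \<otimes>\<^bsub>H\<^esub> k \<in> carrier H" if "h \<in> carrier H" "k \<in> carrier H" for h k
    using that by (auto simp: carrier_holomorph mult_holomorph mult_closed)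
next
  fix h k
  assume "h \<in> carrier H" "k \<in> carrier H"
  then obtain \<alpha> x \<beta> y where h: "h = (\<alpha>, x)" and k: "k = (\<beta>, y)"
    and mem: "\<alpha> \<in> A" "x \<in> carrier Q" "\<beta> \<in> A" "y \<in> carrier Q"
    by (auto simp: carrier_holomorph)
  define \<xi> where "\<xi> = \<beta> \<star> aut_inv \<alpha>"
  have \<xi>: "\<xi> \<in> A" "\<And>\<eta>. \<eta> \<in> A \<Longrightarrow> \<eta> \<star> \<alpha> = \<beta> \<longleftrightarrow> \<eta> = \<xi>"
    using mem aut_right_solution by (auto simp: \<xi>_def)
  obtain v where v: "v \<in> carrier Q" "\<xi> x \<otimes> v = y"
    and v_unique: "\<And>v'. v' \<in> carrier Q \<Longrightarrow> \<xi> x \<otimes> v' = y \<Longrightarrow> v' = v"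
    using left_division[of "\<xi> x" y] mem \<xi>(1) by auto
  show "\<exists>!l. l \<in> carrier H \<and> h \<otimes>\<^bsub>H\<^esub> l = k"
  proof (rule ex1I)
    show "(\<xi>, v) \<in> carrier H \<and> h \<otimes>\<^bsub>H\<^esub> (\<xi>, v) = k"
      using \<xi> v by (simp add: h k carrier_holomorph mult_holomorph)
    show "l = (\<xi>, v)" if "l \<in> carrier H \<and> h \<otimes>\<^bsub>H\<^esub> l = k" for l
      using that \<xi> v_unique by (cases l) (simp add: h k carrier_holomorph mult_holomorph, blast)
  qed
  define \<zeta> where "\<zeta> = aut_inv \<alpha> \<star> \<beta>"
  have \<zeta>: "\<zeta> \<in> A" "\<And>\<eta>. \<eta> \<in> A \<Longrightarrow> \<alpha> \<star> \<eta> = \<beta> \<longleftrightarrow> \<eta> = \<zeta>"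
    using mem aut_left_solution by (auto simp: \<zeta>_def)
  obtain w where w: "w \<in> carrier Q" "w \<otimes> x = y"
    and w_unique: "\<And>w'. w' \<in> carrier Q \<Longrightarrow> w' \<otimes> x = y \<Longrightarrow> w' = w"
    using right_division[of x y] mem by auto
  show "\<exists>!l. l \<in> carrier H \<and> l \<otimes>\<^bsub>H\<^esub> h = k"
  proof (rule ex1I)
    show "(\<zeta>, aut_inv \<alpha> w) \<in> carrier H \<and> (\<zeta>, aut_inv \<alpha> w) \<otimes>\<^bsub>H\<^esub> h = k"
      using \<zeta> w mem by (simp add: h k carrier_holomorph mult_holomorph aut_inv_apply)
    show "l = (\<zeta>, aut_inv \<alpha> w)" if l: "l \<in> carrier H \<and> l \<otimes>\<^bsub>H\<^esub> h = k" for l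
    proof -
      obtain \<eta> u where \<eta>u: "l = (\<eta>, u)" "\<eta> \<in> A" "u \<in> carrier Q"
        using l by (auto simp: carrier_holomorph)
      then have "\<alpha> \<star> \<eta> = \<beta>" "\<alpha> u \<otimes> x = y"
        using l by (simp_all add: h k mult_holomorph)
      then have "\<eta> = \<zeta>" "\<alpha> u = w"
        using \<zeta> w_unique \<eta>u mem by simp_all
      then show ?thesis
        using aut_inv_apply(2) \<eta>u mem by metis
    qed
  qed
next
  show "\<one>\<^bsub>H\<^esub> \<in> carrier H"
    by (simp add: carrier_holomorph one_holomorph one_in_carrier)
  show "\<one>\<^bsub>H\<^esub> \<otimes>\<^bsub>H\<^esub> h = h" "h \<otimes>\<^bsub>H\<^esub> \<one>\<^bsub>H\<^esub> = h" if "h \<in> carrier H" for h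
    using that by (auto simp: carrier_holomorph one_holomorph mult_holomorph aut_fixes_one
        aut_one_apply left_one right_one)
qed

text \<open>
  Both sides have the first component \<open>\<beta>\<gamma>\<beta>\<alpha>\<close> (composed as left actions). In the second
  component the identity is that of \<open>Q\<close> in the variables \<open>\<beta>\<gamma>\<beta> x\<close>, \<open>\<beta>\<gamma> y\<close> and \<open>\<beta> z\<close>, where the
  argument \<open>y\<close> of \<open>\<sigma>\<close> is the image of the second variable under \<open>(\<beta>\<gamma>)\<inverse>\<close>. Conversely,
  \<open>\<beta> = 1\<close> and \<open>\<gamma> = \<theta>\<inverse>\<close> suffice to reach an arbitrary \<open>\<theta>\<close>.
\<close>

lemma right_Bol_identity_holomorph:
  assumes \<sigma>: "\<sigma> \<in> carrier Q \<rightarrow> carrier Q"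
  shows "right_Bol_identity H (holomorph_map \<sigma>) \<longleftrightarrow>
    (\<forall>\<theta> \<in> A. right_Bol_identity Q (\<sigma> \<circ> \<theta>))"
proof -
  have "\<sigma> x \<in> carrier Q" if "x \<in> carrier Q" for x
    using \<sigma> that by blast
  then have expand: "(((\<alpha>, x) \<otimes>\<^bsub>H\<^esub> (\<beta>, y)) \<otimes>\<^bsub>H\<^esub> (\<gamma>, z)) \<otimes>\<^bsub>H\<^esub> holomorph_map \<sigma> (\<beta>, y)
        = (\<alpha>, x) \<otimes>\<^bsub>H\<^esub> (((\<beta>, y) \<otimes>\<^bsub>H\<^esub> (\<gamma>, z)) \<otimes>\<^bsub>H\<^esub> holomorph_map \<sigma> (\<beta>, y))
      \<longleftrightarrow> ((\<beta> (\<gamma> (\<beta> x)) \<otimes> \<beta> (\<gamma> y)) \<otimes> \<beta> z) \<otimes> \<sigma> y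
        = \<beta> (\<gamma> (\<beta> x)) \<otimes> ((\<beta> (\<gamma> y) \<otimes> \<beta> z) \<otimes> \<sigma> y)"
    if "\<alpha> \<in> A" "\<beta> \<in> A" "\<gamma> \<in> A" "x \<in> carrier Q" "y \<in> carrier Q" "z \<in> carrier Q"
    for \<alpha> \<beta> \<gamma> x y z
    using that
    by (simp add: holomorph_map_def mult_holomorph aut_distrib aut_mult_apply mult_closed
        AutG.m_assoc)
  show ?thesis
  proof (intro iffI ballI)
    fix \<theta>
    assume Bol_H: "right_Bol_identity H (holomorph_map \<sigma>)" and \<theta>: "\<theta> \<in> A"
    show "right_Bol_identity Q (\<sigma> \<circ> \<theta>)"
      unfolding right_Bol_identity_def
    proof (intro ballI)
      fix x y z
      assume xyz: "x \<in> carrier Q" "y \<in> carrier Q" "z \<in> carrier Q"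
      let ?e = "\<one>\<^bsub>AutoGroup Q\<^esub>"
      have mem: "?e \<in> A" "aut_inv \<theta> \<in> A" "\<theta> x \<in> carrier Q" "\<theta> y \<in> carrier Q"
        using \<theta> xyz by simp_all
      then have "(?e, \<theta> x) \<in> carrier H" "(?e, \<theta> y) \<in> carrier H" "(aut_inv \<theta>, z) \<in> carrier H"
        using xyz by (simp_all add: carrier_holomorph)
      with Bol_H
      have "(((?e, \<theta> x) \<otimes>\<^bsub>H\<^esub> (?e, \<theta> y)) \<otimes>\<^bsub>H\<^esub> (aut_inv \<theta>, z)) \<otimes>\<^bsub>H\<^esub> holomorph_map \<sigma> (?e, \<theta> y)
          = (?e, \<theta> x) \<otimes>\<^bsub>H\<^esub> (((?e, \<theta> y) \<otimes>\<^bsub>H\<^esub> (aut_inv \<theta>, z)) \<otimes>\<^bsub>H\<^esub> holomorph_map \<sigma> (?e, \<theta> y))"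
        unfolding right_Bol_identity_def by blast
      then show "((x \<otimes> y) \<otimes> z) \<otimes> (\<sigma> \<circ> \<theta>) y = x \<otimes> ((y \<otimes> z) \<otimes> (\<sigma> \<circ> \<theta>) y)"
        using mem xyz \<theta> by (simp add: expand aut_one_apply aut_inv_apply)
    qed
  next
    assume Bol_Q: "\<forall>\<theta> \<in> A. right_Bol_identity Q (\<sigma> \<circ> \<theta>)"
    have "((h \<otimes>\<^bsub>H\<^esub> k) \<otimes>\<^bsub>H\<^esub> l) \<otimes>\<^bsub>H\<^esub> holomorph_map \<sigma> k = h \<otimes>\<^bsub>H\<^esub> ((k \<otimes>\<^bsub>H\<^esub> l) \<otimes>\<^bsub>H\<^esub> holomorph_map \<sigma> k)"
      if hkl: "h \<in> carrier H" "k \<in> carrier H" "l \<in> carrier H" for h k l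
    proof -
      obtain \<alpha> x \<beta> y \<gamma> z where eqs: "h = (\<alpha>, x)" "k = (\<beta>, y)" "l = (\<gamma>, z)"
        and mem: "\<alpha> \<in> A" "\<beta> \<in> A" "\<gamma> \<in> A" "x \<in> carrier Q" "y \<in> carrier Q" "z \<in> carrier Q"
        using hkl by (auto simp: carrier_holomorph)
      define \<theta> where "\<theta> = aut_inv (\<beta> \<star> \<gamma>)"
      have "\<theta> \<in> A" "\<theta> (\<beta> (\<gamma> y)) = y"
        using mem aut_inv_apply(2)[of "\<beta> \<star> \<gamma>" y] by (simp_all add: \<theta>_def aut_mult_apply)
      moreover have "right_Bol_identity Q (\<sigma> \<circ> \<theta>)"
        using Bol_Q \<open>\<theta> \<in> A\<close> by blast
      ultimately have "((\<beta> (\<gamma> (\<beta> x)) \<otimes> \<beta> (\<gamma> y)) \<otimes> \<beta> z) \<otimes> \<sigma> y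
          = \<beta> (\<gamma> (\<beta> x)) \<otimes> ((\<beta> (\<gamma> y) \<otimes> \<beta> z) \<otimes> \<sigma> y)"
        using mem unfolding right_Bol_identity_def by (metis aut_closed comp_apply)
      then show ?thesis
        using expand mem by (simp add: eqs)
    qed
    then show "right_Bol_identity H (holomorph_map \<sigma>)"
      unfolding right_Bol_identity_def by blast
  qed
qed

text \<open>
  Here the new variables are \<open>\<alpha>\<beta> x\<close> and \<open>\<alpha> y\<close>, and \<open>\<theta>\<close> is the inverse of \<open>\<alpha>\<beta>\<close> (composed as
  left actions).
\<close>

lemma flexible_holomorph:
  assumes \<sigma>: "\<sigma> \<in> carrier Q \<rightarrow> carrier Q"
  shows "flexible H (holomorph_map \<sigma>) \<longleftrightarrow> (\<forall>\<theta> \<in> A. flexible Q (\<sigma> \<circ> \<theta>))"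
proof -
  have "\<sigma> x \<in> carrier Q" if "x \<in> carrier Q" for x
    using \<sigma> that by blast
  then have expand: "((\<alpha>, x) \<otimes>\<^bsub>H\<^esub> (\<beta>, y)) \<otimes>\<^bsub>H\<^esub> holomorph_map \<sigma> (\<alpha>, x)
        = (\<alpha>, x) \<otimes>\<^bsub>H\<^esub> ((\<beta>, y) \<otimes>\<^bsub>H\<^esub> holomorph_map \<sigma> (\<alpha>, x))
      \<longleftrightarrow> (\<alpha> (\<beta> x) \<otimes> \<alpha> y) \<otimes> \<sigma> x = \<alpha> (\<beta> x) \<otimes> (\<alpha> y \<otimes> \<sigma> x)"
    if "\<alpha> \<in> A" "\<beta> \<in> A" "x \<in> carrier Q" "y \<in> carrier Q" for \<alpha> \<beta> x y
    using that
    by (simp add: holomorph_map_def mult_holomorph aut_distrib aut_mult_apply mult_closed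
        AutG.m_assoc)
  show ?thesis
  proof (intro iffI ballI)
    fix \<theta>
    assume flex_H: "flexible H (holomorph_map \<sigma>)" and \<theta>: "\<theta> \<in> A"
    show "flexible Q (\<sigma> \<circ> \<theta>)"
      unfolding flexible_def
    proof (intro ballI)
      fix x y
      assume xy: "x \<in> carrier Q" "y \<in> carrier Q"
      let ?e = "\<one>\<^bsub>AutoGroup Q\<^esub>"
      have mem: "?e \<in> A" "aut_inv \<theta> \<in> A" "\<theta> x \<in> carrier Q"
        using \<theta> xy by simp_all
      then have "(?e, \<theta> x) \<in> carrier H" "(aut_inv \<theta>, y) \<in> carrier H"
        using xy by (simp_all add: carrier_holomorph)
      with flex_H
      have "((?e, \<theta> x) \<otimes>\<^bsub>H\<^esub> (aut_inv \<theta>, y)) \<otimes>\<^bsub>H\<^esub> holomorph_map \<sigma> (?e, \<theta> x)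
          = (?e, \<theta> x) \<otimes>\<^bsub>H\<^esub> ((aut_inv \<theta>, y) \<otimes>\<^bsub>H\<^esub> holomorph_map \<sigma> (?e, \<theta> x))"
        unfolding flexible_def by blast
      then show "(x \<otimes> y) \<otimes> (\<sigma> \<circ> \<theta>) x = x \<otimes> (y \<otimes> (\<sigma> \<circ> \<theta>) x)"
        using mem xy \<theta> by (simp add: expand aut_one_apply aut_inv_apply)
    qed
  next
    assume flex_Q: "\<forall>\<theta> \<in> A. flexible Q (\<sigma> \<circ> \<theta>)"
    have "(h \<otimes>\<^bsub>H\<^esub> k) \<otimes>\<^bsub>H\<^esub> holomorph_map \<sigma> h = h \<otimes>\<^bsub>H\<^esub> (k \<otimes>\<^bsub>H\<^esub> holomorph_map \<sigma> h)"
      if hk: "h \<in> carrier H" "k \<in> carrier H" for h k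
    proof -
      obtain \<alpha> x \<beta> y where eqs: "h = (\<alpha>, x)" "k = (\<beta>, y)"
        and mem: "\<alpha> \<in> A" "\<beta> \<in> A" "x \<in> carrier Q" "y \<in> carrier Q"
        using hk by (auto simp: carrier_holomorph)
      define \<theta> where "\<theta> = aut_inv (\<alpha> \<star> \<beta>)"
      have "\<theta> \<in> A" "\<theta> (\<alpha> (\<beta> x)) = x"
        using mem aut_inv_apply(2)[of "\<alpha> \<star> \<beta>" x] by (simp_all add: \<theta>_def aut_mult_apply)
      moreover have "flexible Q (\<sigma> \<circ> \<theta>)"
        using flex_Q \<open>\<theta> \<in> A\<close> by blast
      ultimately have "(\<alpha> (\<beta> x) \<otimes> \<alpha> y) \<otimes> \<sigma> x = \<alpha> (\<beta> x) \<otimes> (\<alpha> y \<otimes> \<sigma> x)"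
        using mem unfolding flexible_def by (metis aut_closed comp_apply)
      then show ?thesis
        using expand mem by (simp add: eqs)
    qed
    then show "flexible H (holomorph_map \<sigma>)"
      unfolding flexible_def by blast
  qed
qed

section \<open>Twisted self-maps of the loop\<close>

lemma A_flexible_iff: "A_flexible A Q \<rho> \<longleftrightarrow> (\<exists>\<delta> \<in> A. flexible Q (\<rho> \<circ> \<delta>))"
  by (simp add: A_flexible_def flexible_def)

lemma A_generalised_flexible_Bol_loop_cong:
  assumes "\<And>x. x \<in> carrier Q \<Longrightarrow> \<rho> x = \<rho>' x"
  shows "A_generalised_flexible_Bol_loop A Q \<rho> \<longleftrightarrow> A_generalised_flexible_Bol_loop A Q \<rho>'"
proof -
  have "\<rho> \<in> carrier Q \<rightarrow> carrier Q \<longleftrightarrow> \<rho>' \<in> carrier Q \<rightarrow> carrier Q"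
    using assms by (simp add: Pi_iff)
  moreover have "right_Bol_identity Q \<rho> \<longleftrightarrow> right_Bol_identity Q \<rho>'"
    using assms by (rule right_Bol_identity_cong)
  moreover have "flexible Q (\<rho> \<circ> \<delta>) \<longleftrightarrow> flexible Q (\<rho>' \<circ> \<delta>)" if "\<delta> \<in> A" for \<delta>
    by (rule flexible_cong) (simp add: assms that)
  ultimately show ?thesis
    by (auto simp: A_generalised_flexible_Bol_loop_def generalised_Bol_loop_iff A_flexible_iff)
qed

lemma all_quotients_iff:
  "(\<forall>\<alpha> \<in> A. \<forall>\<gamma> \<in> A. A_generalised_flexible_Bol_loop A Q (\<lambda>x. \<sigma> (\<alpha> (aut_inv \<gamma> x))))
    \<longleftrightarrow> (\<forall>\<theta> \<in> A. A_generalised_flexible_Bol_loop A Q (\<sigma> \<circ> \<theta>))"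
proof -
  have quotient: "A_generalised_flexible_Bol_loop A Q (\<lambda>x. \<sigma> (\<alpha> (aut_inv \<gamma> x)))
      \<longleftrightarrow> A_generalised_flexible_Bol_loop A Q (\<sigma> \<circ> (\<alpha> \<star> aut_inv \<gamma>))"
    if "\<alpha> \<in> A" "\<gamma> \<in> A" for \<alpha> \<gamma>
    using that by (intro A_generalised_flexible_Bol_loop_cong) (simp add: aut_mult_apply)
  have "\<theta> \<star> aut_inv \<one>\<^bsub>AutoGroup Q\<^esub> = \<theta>" if "\<theta> \<in> A" for \<theta>
    using that by simp
  then show ?thesis
    using quotient Aut.m_closed Aut.m_inv_closed Aut.one_closed by metis
qed

text \<open>
  Every \<open>\<sigma>\<theta>\<close> satisfies the Bol identity, so flexibility for each of them means the same thing,
  the left inverse property.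
\<close>

lemma flexible_twist_uniform:
  assumes "\<forall>\<theta> \<in> A. generalised_Bol_loop Q (\<sigma> \<circ> \<theta>)"
    and "\<tau> \<in> A" "flexible Q (\<sigma> \<circ> \<tau>)" "\<theta> \<in> A"
  shows "flexible Q (\<sigma> \<circ> \<theta>)"
  using assms generalised_Bol_loop.flexible_iff_left_inverse_property by blast

lemma all_A_generalised_flexible_Bol_loop_iff:
  "(\<forall>\<theta> \<in> A. A_generalised_flexible_Bol_loop A Q (\<sigma> \<circ> \<theta>))
    \<longleftrightarrow> (\<forall>\<theta> \<in> A. generalised_Bol_loop Q (\<sigma> \<circ> \<theta>) \<and> flexible Q (\<sigma> \<circ> \<theta>))"
proof
  assume L: "\<forall>\<theta> \<in> A. A_generalised_flexible_Bol_loop A Q (\<sigma> \<circ> \<theta>)"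
  then have Bol: "\<forall>\<theta> \<in> A. generalised_Bol_loop Q (\<sigma> \<circ> \<theta>)"
    by (simp add: A_generalised_flexible_Bol_loop_def)
  obtain \<delta> where \<delta>: "\<delta> \<in> A" "flexible Q (\<sigma> \<circ> \<one>\<^bsub>AutoGroup Q\<^esub> \<circ> \<delta>)"
    using L Aut.one_closed unfolding A_generalised_flexible_Bol_loop_def A_flexible_iff by blast
  have "flexible Q (\<sigma> \<circ> \<delta>)"
    using \<delta> flexible_cong[of Q "\<sigma> \<circ> \<one>\<^bsub>AutoGroup Q\<^esub> \<circ> \<delta>" "\<sigma> \<circ> \<delta>"] by (simp add: aut_one_apply)
  then show "\<forall>\<theta> \<in> A. generalised_Bol_loop Q (\<sigma> \<circ> \<theta>) \<and> flexible Q (\<sigma> \<circ> \<theta>)"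
    using Bol \<delta> flexible_twist_uniform by blast
next
  assume R: "\<forall>\<theta> \<in> A. generalised_Bol_loop Q (\<sigma> \<circ> \<theta>) \<and> flexible Q (\<sigma> \<circ> \<theta>)"
  have "A_flexible A Q (\<sigma> \<circ> \<theta>)" if "\<theta> \<in> A" for \<theta>
  proof -
    have "flexible Q (\<sigma> \<circ> \<theta> \<circ> \<one>\<^bsub>AutoGroup Q\<^esub>)"
      using R that flexible_cong[of Q "\<sigma> \<circ> \<theta> \<circ> \<one>\<^bsub>AutoGroup Q\<^esub>" "\<sigma> \<circ> \<theta>"]
      by (simp add: aut_one_apply)
    then show ?thesis
      unfolding A_flexible_iff using Aut.one_closed by blast
  qed
  then show "\<forall>\<theta> \<in> A. A_generalised_flexible_Bol_loop A Q (\<sigma> \<circ> \<theta>)"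
    using R by (simp add: A_generalised_flexible_Bol_loop_def)
qed

lemma generalised_flexible_Bol_loop_holomorph:
  assumes \<sigma>: "\<sigma> \<in> carrier Q \<rightarrow> carrier Q"
  shows "generalised_flexible_Bol_loop H (holomorph_map \<sigma>)
    \<longleftrightarrow> (\<forall>\<theta> \<in> A. generalised_Bol_loop Q (\<sigma> \<circ> \<theta>) \<and> flexible Q (\<sigma> \<circ> \<theta>))"
proof -
  have "holomorph_map \<sigma> \<in> carrier H \<rightarrow> carrier H"
    using \<sigma> by (auto simp: carrier_holomorph holomorph_map_def)
  moreover have "\<sigma> \<circ> \<theta> \<in> carrier Q \<rightarrow> carrier Q" if "\<theta> \<in> A" for \<theta>
    using \<sigma> that by auto
  ultimately show ?thesis
    using \<sigma> loop_holomorph loop_axioms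
    by (auto simp: generalised_flexible_Bol_loop_def generalised_Bol_loop_iff
        right_Bol_identity_holomorph flexible_holomorph)
qed

end

theorem theorem3p3:
  fixes Q :: "('a, 'm) monoid_scheme"
    and \<sigma> :: "'a \<Rightarrow> 'a"
    and A :: "('a \<Rightarrow> 'a) set"
  assumes "loop Q"
    and "\<sigma> \<in> carrier Q \<rightarrow> carrier Q"
    and "subgroup A (AutoGroup Q)"
  shows "(\<forall>\<alpha> \<in> A. \<forall>\<gamma> \<in> A.
            A_generalised_flexible_Bol_loop A Q (\<lambda>x. \<sigma> (\<alpha> ((inv\<^bsub>AutoGroup Q\<^esub> \<gamma>) x))))
         \<longleftrightarrow> generalised_flexible_Bol_loop (holomorph A Q) (holomorph_map \<sigma>)"
proof -
  interpret loop_automorphisms Q A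
    using assms by (simp add: loop_automorphisms_def)
  show ?thesis
    using all_quotients_iff all_A_generalised_flexible_Bol_loop_iff
      generalised_flexible_Bol_loop_holomorph[OF assms(2)] by simp
qed

end
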